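(* Let $\sigma$ be a signature. For all sets $\Gamma\subseteq\mathrm{Sent}_\sigma$ and $\Delta\subseteq\mathrm{Form}_\sigma$: if $\Gamma\vdash_\sharp\Delta$ then $\Gamma\vDash_\sharp\Delta$.
   Context: Syntax. Signature $\sigma$: predicate symbols (with arities) and constants, no function symbols; terms are variables (fixed countable set) and constants. $\mathrm{Form}_\sigma$: formulas built from atomic formulas and $\bot$ by $\rightarrow,\wedge,\vee$, strong negation $\sim$, $\Box,\Diamond$, $\forall x,\exists x$; $\mathrm{Sent}_\sigma$: sentences. Abbreviations: $\neg\Phi:=\Phi\rightarrow\bot$, $\Phi\leftrightarrow\Psi:=(\Phi\rightarrow\Psi)\wedge(\Psi\rightarrow\Phi)$, $\Phi\Leftrightarrow\Psi:=(\Phi\leftrightarrow\Psi)\wedge({\sim\Phi}\leftrightarrow{\sim\Psi})$. Calculus. $\mathsf{QBK}^\sharp_\sigma$ is the smallest set of $\sigma$-formulas containing all instances of the following schemes and closed under the rules below: $\Phi\rightarrow(\Psi\rightarrow\Phi)$; $(\Phi\rightarrow(\Psi\rightarrow\Theta))\rightarrow((\Phi\rightarrow\Psi)\rightarrow(\Phi\rightarrow\Theta))$; $\Phi\wedge\Psi\rightarrow\Phi$; $\Phi\wedge\Psi\rightarrow\Psi$; $\Phi\rightarrow(\Psi\rightarrow\Phi\wedge\Psi)$; $\Phi\rightarrow\Phi\vee\Psi$; $\Psi\rightarrow\Phi\vee\Psi$; $(\Phi\rightarrow\Theta)\rightarrow((\Psi\rightarrow\Theta)\rightarrow(\Phi\vee\Psi\rightarrow\Theta))$;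 $\Phi\vee(\Phi\rightarrow\bot)$; $\bot\rightarrow\Phi$; ${\sim\sim\Phi}\leftrightarrow\Phi$; ${\sim(\Phi\rightarrow\Psi)}\leftrightarrow(\Phi\wedge{\sim\Psi})$; ${\sim(\Phi\vee\Psi)}\leftrightarrow({\sim\Phi}\wedge{\sim\Psi})$; ${\sim(\Phi\wedge\Psi)}\leftrightarrow({\sim\Phi}\vee{\sim\Psi})$; ${\sim\bot}$; $(\Box\Phi\wedge\Box\Psi)\rightarrow\Box(\Phi\wedge\Psi)$; $\Box(\Phi\rightarrow\Phi)$; $\neg\Box\Phi\leftrightarrow\Diamond\neg\Phi$; $\neg\Diamond\Phi\leftrightarrow\Box\neg\Phi$; $\Box\Phi\Leftrightarrow{\sim\Diamond{\sim\Phi}}$; $\Diamond\Phi\Leftrightarrow{\sim\Box{\sim\Phi}}$; $\forall x\Phi\rightarrow\Phi(x/t)$, $\Phi(x/t)\rightarrow\exists x\Phi$ ($t$ free for $x$ in $\Phi$); ${\sim\forall x\Phi}\leftrightarrow\exists x{\sim\Phi}$; ${\sim\exists x\Phi}\leftrightarrow\forall x{\sim\Phi}$; and the Barcan scheme $\Diamond\exists x\Phi\rightarrow\exists x\Diamond\Phi$. Rules: MP (from $\Phi,\Phi\rightarrow\Psi$ infer $\Psi$), MB (from $\Phi\rightarrow\Psi$ infer $\Box\Phi\rightarrow\Box\Psi$), MD (from $\Phi\rightarrow\Psi$ infer $\Diamond\Phi\rightarrow\Diamond\Psi$), BR1 (from $\Phi\rightarrow\Psi$ infer $\Phi\rightarrow\forall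 x\Psi$, $x$ not free in $\Phi$), BR2 (from $\Phi\rightarrow\Psi$ infer $\exists x\Phi\rightarrow\Psi$, $x$ not free in $\Psi$). $\mathrm{Disj}(\Delta)$: disjunctions of finitely many elements of $\Delta$ (empty $=\bot$). $\Gamma\vdash_\sharp\Delta$ iff some element of $\mathrm{Disj}(\Delta)$ is obtainable from $\Gamma\cup\mathsf{QBK}^\sharp_\sigma$ using only MP, BR1, BR2. Semantics. A $\mathsf{QBK}_\sigma$-model is $\mathcal M=\langle\langle W,R\rangle,(\mathfrak A^+_w),(\mathfrak A^-_w)\rangle$ ($W\ne\emptyset$, $R\subseteq W\times W$), $\mathfrak A^\pm_w$ $\sigma$-structures with common domain $A_w$ and equal interpretation of constants, with $uRv\Rightarrow A_u\subseteq A_v$ and constants of $\sigma$ interpreted equally in $\mathfrak A^+_u,\mathfrak A^+_v$. A $\mathsf{QBK}^\sharp_\sigma$-model is a $\mathsf{QBK}_\sigma$-model with $A_u=A_v$ for all worlds $u,v$. $A$-sentences: sentences over $\sigma$ plus constants $\underline a$ ($a\in A$) naming $a$; ground $A$-substitutions map variables to such constants. Verification/falsification at $w$: atomic by $\mathfrak A^+_w$ / $\mathfrak A^-_w$; $\bot$ never verified, always falsified; $\wedge$: verified iff both verified, falsified iff one falsified; $\vee$ dually; $\Phi\rightarrow\Psi$: verified iff $\Phi$ not verified or $\Psi$ verified, falsified iff $\Phi$ verified and $\Psi$ falsified; $\sim$ swaps; $\Box\Phi$: verified iff $\Phi$ verified at all $R$-successors, falsified iff falsified at some $R$-successor; $\Diamond\Phi$: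 verified iff verified at some $R$-successor, falsified iff falsified at all; $\forall x\Phi$: verified iff $\Phi(x/\underline a)$ verified for all $a\in A_w$, falsified iff falsified for some; $\exists x\Phi$: verified iff verified for some $a\in A_w$, falsified iff falsified for all. $\Gamma\vDash_\sharp\Delta$ iff for every $\mathsf{QBK}^\sharp_\sigma$-model $\mathcal M$, world $w$, ground $A_w$-substitution $\lambda$: if all of $\Gamma$ is verified at $w$ then $\lambda\Psi$ is verified at $w$ for some $\Psi\in\Delta$. *)

theory Defs
  imports Main
begin

section \<open>Syntax\<close>

record ('p, 'c) signature =
  predicates :: "'p set"
  arity :: "'p \<Rightarrow> nat"
  constants :: "'c set"

datatype 'c trm = Var nat | Cst 'c

datatype ('p, 'c) form =
    Atom 'p "'c trm list"
  | Bot ("\<^bold>\<bottom>")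
  | Imp "('p, 'c) form" "('p, 'c) form" (infixr "\<^bold>\<longrightarrow>" 55)
  | And "('p, 'c) form" "('p, 'c) form" (infixr "\<^bold>\<and>" 65)
  | Or "('p, 'c) form" "('p, 'c) form" (infixr "\<^bold>\<or>" 60)
  | SNeg "('p, 'c) form" ("\<^bold>\<sim> _" [70] 70)
  | Box "('p, 'c) form" ("\<^bold>\<box> _" [70] 70)
  | Dia "('p, 'c) form" ("\<^bold>\<diamond> _" [70] 70)
  | All nat "('p, 'c) form" ("\<^bold>\<forall>_. _" [0, 70] 70)
  | Exi nat "('p, 'c) form" ("\<^bold>\<exists>_. _" [0, 70] 70)

abbreviation Neg :: "('p, 'c) form \<Rightarrow> ('p, 'c) form" ("\<^bold>\<not> _" [70] 70) where
  "\<^bold>\<not> \<Phi> \<equiv> \<Phi> \<^bold>\<longrightarrow> \<^bold>\<bottom>"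

abbreviation Iff :: "('p, 'c) form \<Rightarrow> ('p, 'c) form \<Rightarrow> ('p, 'c) form"
    (infixr "\<^bold>\<longleftrightarrow>" 53) where
  "\<Phi> \<^bold>\<longleftrightarrow> \<Psi> \<equiv> (\<Phi> \<^bold>\<longrightarrow> \<Psi>) \<^bold>\<and> (\<Psi> \<^bold>\<longrightarrow> \<Phi>)"

abbreviation SIff :: "('p, 'c) form \<Rightarrow> ('p, 'c) form \<Rightarrow> ('p, 'c) form"
    (infixr "\<^bold>\<Longleftrightarrow>" 53) where
  "\<Phi> \<^bold>\<Longleftrightarrow> \<Psi> \<equiv> (\<Phi> \<^bold>\<longleftrightarrow> \<Psi>) \<^bold>\<and> (\<^bold>\<sim> \<Phi> \<^bold>\<longleftrightarrow> \<^bold>\<sim> \<Psi>)"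

primrec tvars :: "'c trm \<Rightarrow> nat set" where
  "tvars (Var x) = {x}"
| "tvars (Cst c) = {}"

primrec fv :: "('p, 'c) form \<Rightarrow> nat set" where
  "fv (Atom P ts) = (\<Union>t\<in>set ts. tvars t)"
| "fv \<^bold>\<bottom> = {}"
| "fv (\<Phi> \<^bold>\<longrightarrow> \<Psi>) = fv \<Phi> \<union> fv \<Psi>"
| "fv (\<Phi> \<^bold>\<and> \<Psi>) = fv \<Phi> \<union> fv \<Psi>"
| "fv (\<Phi> \<^bold>\<or> \<Psi>) = fv \<Phi> \<union> fv \<Psi>"
| "fv (\<^bold>\<sim> \<Phi>) = fv \<Phi>"
| "fv (\<^bold>\<box> \<Phi>) = fv \<Phi>"
| "fv (\<^bold>\<diamond> \<Phi>) = fv \<Phi>"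
| "fv (\<^bold>\<forall>x. \<Phi>) = fv \<Phi> - {x}"
| "fv (\<^bold>\<exists>x. \<Phi>) = fv \<Phi> - {x}"

definition Term :: "('p, 'c) signature \<Rightarrow> 'c trm set" where
  "Term \<sigma> = {t. set_trm t \<subseteq> constants \<sigma>}"

primrec wf_form :: "('p, 'c) signature \<Rightarrow> ('p, 'c) form \<Rightarrow> bool" where
  "wf_form \<sigma> (Atom P ts) \<longleftrightarrow>
     P \<in> predicates \<sigma> \<and> length ts = arity \<sigma> P \<and> set ts \<subseteq> Term \<sigma>"
| "wf_form \<sigma> \<^bold>\<bottom> \<longleftrightarrow> True"
| "wf_form \<sigma> (\<Phi> \<^bold>\<longrightarrow> \<Psi>) \<longleftrightarrow> wf_form \<sigma> \<Phi> \<and> wf_form \<sigma> \<Psi>"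
| "wf_form \<sigma> (\<Phi> \<^bold>\<and> \<Psi>) \<longleftrightarrow> wf_form \<sigma> \<Phi> \<and> wf_form \<sigma> \<Psi>"
| "wf_form \<sigma> (\<Phi> \<^bold>\<or> \<Psi>) \<longleftrightarrow> wf_form \<sigma> \<Phi> \<and> wf_form \<sigma> \<Psi>"
| "wf_form \<sigma> (\<^bold>\<sim> \<Phi>) \<longleftrightarrow> wf_form \<sigma> \<Phi>"
| "wf_form \<sigma> (\<^bold>\<box> \<Phi>) \<longleftrightarrow> wf_form \<sigma> \<Phi>"
| "wf_form \<sigma> (\<^bold>\<diamond> \<Phi>) \<longleftrightarrow> wf_form \<sigma> \<Phi>"
| "wf_form \<sigma> (\<^bold>\<forall>x. \<Phi>) \<longleftrightarrow> wf_form \<sigma> \<Phi>"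
| "wf_form \<sigma> (\<^bold>\<exists>x. \<Phi>) \<longleftrightarrow> wf_form \<sigma> \<Phi>"

definition Form :: "('p, 'c) signature \<Rightarrow> ('p, 'c) form set" where
  "Form \<sigma> = {\<Phi>. wf_form \<sigma> \<Phi>}"

definition Sent :: "('p, 'c) signature \<Rightarrow> ('p, 'c) form set" where
  "Sent \<sigma> = {\<Phi> \<in> Form \<sigma>. fv \<Phi> = {}}"

primrec tsubst :: "(nat \<Rightarrow> 'c trm) \<Rightarrow> 'c trm \<Rightarrow> 'c trm" where
  "tsubst s (Var x) = s x"
| "tsubst s (Cst c) = Cst c"

text \<open>Simultaneous replacement of free occurrences, without renaming of bound variables.
  Variable capture is excluded by \<open>free_for\<close>, or because the substituted terms are constants.\<close>

primrec subst :: "(nat \<Rightarrow> 'c trm) \<Rightarrow> ('p, 'c) form \<Rightarrow> ('p, 'c) form" where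
  "subst s (Atom P ts) = Atom P (map (tsubst s) ts)"
| "subst s \<^bold>\<bottom> = \<^bold>\<bottom>"
| "subst s (\<Phi> \<^bold>\<longrightarrow> \<Psi>) = subst s \<Phi> \<^bold>\<longrightarrow> subst s \<Psi>"
| "subst s (\<Phi> \<^bold>\<and> \<Psi>) = subst s \<Phi> \<^bold>\<and> subst s \<Psi>"
| "subst s (\<Phi> \<^bold>\<or> \<Psi>) = subst s \<Phi> \<^bold>\<or> subst s \<Psi>"
| "subst s (\<^bold>\<sim> \<Phi>) = \<^bold>\<sim> (subst s \<Phi>)"
| "subst s (\<^bold>\<box> \<Phi>) = \<^bold>\<box> (subst s \<Phi>)"
| "subst s (\<^bold>\<diamond> \<Phi>) = \<^bold>\<diamond> (subst s \<Phi>)"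
| "subst s (\<^bold>\<forall>x. \<Phi>) = (\<^bold>\<forall>x. (subst (s(x := Var x)) \<Phi>))"
| "subst s (\<^bold>\<exists>x. \<Phi>) = (\<^bold>\<exists>x. (subst (s(x := Var x)) \<Phi>))"

definition subst1 :: "('p, 'c) form \<Rightarrow> nat \<Rightarrow> 'c trm \<Rightarrow> ('p, 'c) form" where
  "subst1 \<Phi> x t = subst (Var(x := t)) \<Phi>"

primrec free_for :: "'c trm \<Rightarrow> nat \<Rightarrow> ('p, 'c) form \<Rightarrow> bool" where
  "free_for t x (Atom P ts) \<longleftrightarrow> True"
| "free_for t x \<^bold>\<bottom> \<longleftrightarrow> True"
| "free_for t x (\<Phi> \<^bold>\<longrightarrow> \<Psi>) \<longleftrightarrow> free_for t x \<Phi> \<and> free_for t x \<Psi>"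
| "free_for t x (\<Phi> \<^bold>\<and> \<Psi>) \<longleftrightarrow> free_for t x \<Phi> \<and> free_for t x \<Psi>"
| "free_for t x (\<Phi> \<^bold>\<or> \<Psi>) \<longleftrightarrow> free_for t x \<Phi> \<and> free_for t x \<Psi>"
| "free_for t x (\<^bold>\<sim> \<Phi>) \<longleftrightarrow> free_for t x \<Phi>"
| "free_for t x (\<^bold>\<box> \<Phi>) \<longleftrightarrow> free_for t x \<Phi>"
| "free_for t x (\<^bold>\<diamond> \<Phi>) \<longleftrightarrow> free_for t x \<Phi>"
| "free_for t x (\<^bold>\<forall>y. \<Phi>) \<longleftrightarrow> x \<notin> fv (\<^bold>\<forall>y. \<Phi>) \<or> y \<notin> tvars t \<and> free_for t x \<Phi>"
| "free_for t x (\<^bold>\<exists>y. \<Phi>) \<longleftrightarrow> x \<notin> fv (\<^bold>\<exists>y. \<Phi>) \<or> y \<notin> tvars t \<and> free_for t x \<Phi>"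


section \<open>Calculus\<close>

inductive_set axioms :: "('p, 'c) form set" where
  "\<Phi> \<^bold>\<longrightarrow> (\<Psi> \<^bold>\<longrightarrow> \<Phi>) \<in> axioms"
| "(\<Phi> \<^bold>\<longrightarrow> (\<Psi> \<^bold>\<longrightarrow> \<Theta>)) \<^bold>\<longrightarrow> ((\<Phi> \<^bold>\<longrightarrow> \<Psi>) \<^bold>\<longrightarrow> (\<Phi> \<^bold>\<longrightarrow> \<Theta>)) \<in> axioms"
| "(\<Phi> \<^bold>\<and> \<Psi>) \<^bold>\<longrightarrow> \<Phi> \<in> axioms"
| "(\<Phi> \<^bold>\<and> \<Psi>) \<^bold>\<longrightarrow> \<Psi> \<in> axioms"
| "\<Phi> \<^bold>\<longrightarrow> (\<Psi> \<^bold>\<longrightarrow> (\<Phi> \<^bold>\<and> \<Psi>)) \<in> axioms"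
| "\<Phi> \<^bold>\<longrightarrow> (\<Phi> \<^bold>\<or> \<Psi>) \<in> axioms"
| "\<Psi> \<^bold>\<longrightarrow> (\<Phi> \<^bold>\<or> \<Psi>) \<in> axioms"
| "(\<Phi> \<^bold>\<longrightarrow> \<Theta>) \<^bold>\<longrightarrow> ((\<Psi> \<^bold>\<longrightarrow> \<Theta>) \<^bold>\<longrightarrow> ((\<Phi> \<^bold>\<or> \<Psi>) \<^bold>\<longrightarrow> \<Theta>)) \<in> axioms"
| "\<Phi> \<^bold>\<or> (\<Phi> \<^bold>\<longrightarrow> \<^bold>\<bottom>) \<in> axioms"
| "\<^bold>\<bottom> \<^bold>\<longrightarrow> \<Phi> \<in> axioms"
| "(\<^bold>\<sim> (\<^bold>\<sim> \<Phi>)) \<^bold>\<longleftrightarrow> \<Phi> \<in> axioms"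
| "(\<^bold>\<sim> (\<Phi> \<^bold>\<longrightarrow> \<Psi>)) \<^bold>\<longleftrightarrow> (\<Phi> \<^bold>\<and> (\<^bold>\<sim> \<Psi>)) \<in> axioms"
| "(\<^bold>\<sim> (\<Phi> \<^bold>\<or> \<Psi>)) \<^bold>\<longleftrightarrow> ((\<^bold>\<sim> \<Phi>) \<^bold>\<and> (\<^bold>\<sim> \<Psi>)) \<in> axioms"
| "(\<^bold>\<sim> (\<Phi> \<^bold>\<and> \<Psi>)) \<^bold>\<longleftrightarrow> ((\<^bold>\<sim> \<Phi>) \<^bold>\<or> (\<^bold>\<sim> \<Psi>)) \<in> axioms"
| "\<^bold>\<sim> \<^bold>\<bottom> \<in> axioms"
| "((\<^bold>\<box> \<Phi>) \<^bold>\<and> (\<^bold>\<box> \<Psi>)) \<^bold>\<longrightarrow> (\<^bold>\<box> (\<Phi> \<^bold>\<and> \<Psi>)) \<in> axioms"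
| "\<^bold>\<box> (\<Phi> \<^bold>\<longrightarrow> \<Phi>) \<in> axioms"
| "(\<^bold>\<not> (\<^bold>\<box> \<Phi>)) \<^bold>\<longleftrightarrow> (\<^bold>\<diamond> (\<^bold>\<not> \<Phi>)) \<in> axioms"
| "(\<^bold>\<not> (\<^bold>\<diamond> \<Phi>)) \<^bold>\<longleftrightarrow> (\<^bold>\<box> (\<^bold>\<not> \<Phi>)) \<in> axioms"
| "(\<^bold>\<box> \<Phi>) \<^bold>\<Longleftrightarrow> (\<^bold>\<sim> (\<^bold>\<diamond> (\<^bold>\<sim> \<Phi>))) \<in> axioms"
| "(\<^bold>\<diamond> \<Phi>) \<^bold>\<Longleftrightarrow> (\<^bold>\<sim> (\<^bold>\<box> (\<^bold>\<sim> \<Phi>))) \<in> axioms"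
| "free_for t x \<Phi> \<Longrightarrow> (\<^bold>\<forall>x. \<Phi>) \<^bold>\<longrightarrow> subst1 \<Phi> x t \<in> axioms"
| "free_for t x \<Phi> \<Longrightarrow> subst1 \<Phi> x t \<^bold>\<longrightarrow> (\<^bold>\<exists>x. \<Phi>) \<in> axioms"
| "(\<^bold>\<sim> (\<^bold>\<forall>x. \<Phi>)) \<^bold>\<longleftrightarrow> (\<^bold>\<exists>x. (\<^bold>\<sim> \<Phi>)) \<in> axioms"
| "(\<^bold>\<sim> (\<^bold>\<exists>x. \<Phi>)) \<^bold>\<longleftrightarrow> (\<^bold>\<forall>x. (\<^bold>\<sim> \<Phi>)) \<in> axioms"
| "(\<^bold>\<diamond> (\<^bold>\<exists>x. \<Phi>)) \<^bold>\<longrightarrow> (\<^bold>\<exists>x. (\<^bold>\<diamond> \<Phi>)) \<in> axioms"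

text \<open>The instances of the schemes in the language of \<open>\<sigma>\<close> are those members of \<open>axioms\<close> that
  lie in \<open>Form \<sigma>\<close>: every formula (and, if \<open>x\<close> occurs free in \<open>\<Phi>\<close>, the term \<open>t\<close>) instantiating
  a scheme occurs in the instance.\<close>

inductive_set QBK_sharp :: "('p, 'c) signature \<Rightarrow> ('p, 'c) form set"
  for \<sigma> :: "('p, 'c) signature" where
  Ax: "\<Phi> \<in> axioms \<Longrightarrow> \<Phi> \<in> Form \<sigma> \<Longrightarrow> \<Phi> \<in> QBK_sharp \<sigma>"
| MP: "\<Phi> \<in> QBK_sharp \<sigma> \<Longrightarrow> \<Phi> \<^bold>\<longrightarrow> \<Psi> \<in> QBK_sharp \<sigma> \<Longrightarrow> \<Psi> \<in> QBK_sharp \<sigma>"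
| MB: "\<Phi> \<^bold>\<longrightarrow> \<Psi> \<in> QBK_sharp \<sigma> \<Longrightarrow> (\<^bold>\<box> \<Phi>) \<^bold>\<longrightarrow> (\<^bold>\<box> \<Psi>) \<in> QBK_sharp \<sigma>"
| MD: "\<Phi> \<^bold>\<longrightarrow> \<Psi> \<in> QBK_sharp \<sigma> \<Longrightarrow> (\<^bold>\<diamond> \<Phi>) \<^bold>\<longrightarrow> (\<^bold>\<diamond> \<Psi>) \<in> QBK_sharp \<sigma>"
| BR1: "\<Phi> \<^bold>\<longrightarrow> \<Psi> \<in> QBK_sharp \<sigma> \<Longrightarrow> x \<notin> fv \<Phi> \<Longrightarrow> \<Phi> \<^bold>\<longrightarrow> (\<^bold>\<forall>x. \<Psi>) \<in> QBK_sharp \<sigma>"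
| BR2: "\<Phi> \<^bold>\<longrightarrow> \<Psi> \<in> QBK_sharp \<sigma> \<Longrightarrow> x \<notin> fv \<Psi> \<Longrightarrow> (\<^bold>\<exists>x. \<Phi>) \<^bold>\<longrightarrow> \<Psi> \<in> QBK_sharp \<sigma>"

inductive_set obtainable :: "('p, 'c) signature \<Rightarrow> ('p, 'c) form set \<Rightarrow> ('p, 'c) form set"
  for \<sigma> :: "('p, 'c) signature" and \<Gamma> :: "('p, 'c) form set" where
  Hyp: "\<Phi> \<in> \<Gamma> \<union> QBK_sharp \<sigma> \<Longrightarrow> \<Phi> \<in> obtainable \<sigma> \<Gamma>"
| MP: "\<Phi> \<in> obtainable \<sigma> \<Gamma> \<Longrightarrow> \<Phi> \<^bold>\<longrightarrow> \<Psi> \<in> obtainable \<sigma> \<Gamma> \<Longrightarrow> \<Psi> \<in> obtainable \<sigma> \<Gamma>"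
| BR1: "\<Phi> \<^bold>\<longrightarrow> \<Psi> \<in> obtainable \<sigma> \<Gamma> \<Longrightarrow> x \<notin> fv \<Phi> \<Longrightarrow> \<Phi> \<^bold>\<longrightarrow> (\<^bold>\<forall>x. \<Psi>) \<in> obtainable \<sigma> \<Gamma>"
| BR2: "\<Phi> \<^bold>\<longrightarrow> \<Psi> \<in> obtainable \<sigma> \<Gamma> \<Longrightarrow> x \<notin> fv \<Psi> \<Longrightarrow> (\<^bold>\<exists>x. \<Phi>) \<^bold>\<longrightarrow> \<Psi> \<in> obtainable \<sigma> \<Gamma>"

fun disj_list :: "('p, 'c) form list \<Rightarrow> ('p, 'c) form" where
  "disj_list [] = \<^bold>\<bottom>"
| "disj_list [\<Phi>] = \<Phi>"
| "disj_list (\<Phi> # \<Psi> # \<Theta>s) = \<Phi> \<^bold>\<or> disj_list (\<Psi> # \<Theta>s)"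

definition Disj :: "('p, 'c) form set \<Rightarrow> ('p, 'c) form set" where
  "Disj \<Delta> = {disj_list \<Phi>s |\<Phi>s. set \<Phi>s \<subseteq> \<Delta>}"

definition derives_sharp ::
    "('p, 'c) signature \<Rightarrow> ('p, 'c) form set \<Rightarrow> ('p, 'c) form set \<Rightarrow> bool" where
  "derives_sharp \<sigma> \<Gamma> \<Delta> \<longleftrightarrow> (\<exists>\<Phi> \<in> Disj \<Delta>. \<Phi> \<in> obtainable \<sigma> \<Gamma>)"


section \<open>Semantics\<close>

record ('p, 'c, 'a) struct =
  domain :: "'a set"
  pred_int :: "'p \<Rightarrow> 'a list set"
  const_int :: "'c \<Rightarrow> 'a"

definition is_struct :: "('p, 'c) signature \<Rightarrow> ('p, 'c, 'a) struct \<Rightarrow> bool" where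
  "is_struct \<sigma> \<AA> \<longleftrightarrow>
     domain \<AA> \<noteq> {} \<and>
     (\<forall>P \<in> predicates \<sigma>. pred_int \<AA> P \<subseteq> {as. length as = arity \<sigma> P \<and> set as \<subseteq> domain \<AA>}) \<and>
     (\<forall>c \<in> constants \<sigma>. const_int \<AA> c \<in> domain \<AA>)"

record ('w, 'p, 'c, 'a) model =
  worlds :: "'w set"
  acc :: "('w \<times> 'w) set"
  pos :: "'w \<Rightarrow> ('p, 'c, 'a) struct"
  neg :: "'w \<Rightarrow> ('p, 'c, 'a) struct"

abbreviation world_domain :: "('w, 'p, 'c, 'a) model \<Rightarrow> 'w \<Rightarrow> 'a set" where
  "world_domain M w \<equiv> domain (pos M w)"

definition QBK_model :: "('p, 'c) signature \<Rightarrow> ('w, 'p, 'c, 'a) model \<Rightarrow> bool" where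
  "QBK_model \<sigma> M \<longleftrightarrow>
     worlds M \<noteq> {} \<and>
     acc M \<subseteq> worlds M \<times> worlds M \<and>
     (\<forall>w \<in> worlds M.
        is_struct \<sigma> (pos M w) \<and> is_struct \<sigma> (neg M w) \<and>
        domain (pos M w) = domain (neg M w) \<and>
        (\<forall>c \<in> constants \<sigma>. const_int (pos M w) c = const_int (neg M w) c)) \<and>
     (\<forall>(u, v) \<in> acc M.
        world_domain M u \<subseteq> world_domain M v \<and>
        (\<forall>c \<in> constants \<sigma>. const_int (pos M u) c = const_int (pos M v) c))"

definition QBK_sharp_model :: "('p, 'c) signature \<Rightarrow> ('w, 'p, 'c, 'a) model \<Rightarrow> bool" where
  "QBK_sharp_model \<sigma> M \<longleftrightarrow>
     QBK_model \<sigma> M \<and>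
     (\<forall>u \<in> worlds M. \<forall>v \<in> worlds M. world_domain M u = world_domain M v)"

text \<open>Formulas of the language expanded by names for the elements of the domain have constants
  of type \<^typ>\<open>'c + 'a\<close>: \<open>Inl c\<close> is the constant \<open>c\<close> of the signature, and \<open>Inr a\<close> is the
  name of \<open>a\<close>.\<close>

abbreviation name :: "'a \<Rightarrow> ('c + 'a) trm" where
  "name a \<equiv> Cst (Inr a)"

abbreviation expand :: "('p, 'c) form \<Rightarrow> ('p, 'c + 'a) form" where
  "expand \<equiv> map_form id Inl"

text \<open>Only closed terms are ever evaluated in a sentence, so the value of a variable is
  irrelevant.\<close>

fun tval :: "('p, 'c, 'a) struct \<Rightarrow> ('c + 'a) trm \<Rightarrow> 'a" where
  "tval \<AA> (Cst (Inl c)) = const_int \<AA> c"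
| "tval \<AA> (Cst (Inr a)) = a"
| "tval \<AA> (Var x) = undefined"

primrec complexity :: "('p, 'c) form \<Rightarrow> nat" where
  "complexity (Atom P ts) = 0"
| "complexity \<^bold>\<bottom> = 0"
| "complexity (\<Phi> \<^bold>\<longrightarrow> \<Psi>) = Suc (complexity \<Phi> + complexity \<Psi>)"
| "complexity (\<Phi> \<^bold>\<and> \<Psi>) = Suc (complexity \<Phi> + complexity \<Psi>)"
| "complexity (\<Phi> \<^bold>\<or> \<Psi>) = Suc (complexity \<Phi> + complexity \<Psi>)"
| "complexity (\<^bold>\<sim> \<Phi>) = Suc (complexity \<Phi>)"
| "complexity (\<^bold>\<box> \<Phi>) = Suc (complexity \<Phi>)"
| "complexity (\<^bold>\<diamond> \<Phi>) = Suc (complexity \<Phi>)"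
| "complexity (\<^bold>\<forall>x. \<Phi>) = Suc (complexity \<Phi>)"
| "complexity (\<^bold>\<exists>x. \<Phi>) = Suc (complexity \<Phi>)"

lemma complexity_subst [simp]: "complexity (subst s \<Phi>) = complexity \<Phi>"
  by (induction \<Phi> arbitrary: s) simp_all

lemma complexity_subst1 [simp]: "complexity (subst1 \<Phi> x t) = complexity \<Phi>"
  by (simp add: subst1_def)

function (sequential)
  verified :: "('w, 'p, 'c, 'a) model \<Rightarrow> 'w \<Rightarrow> ('p, 'c + 'a) form \<Rightarrow> bool" and
  falsified :: "('w, 'p, 'c, 'a) model \<Rightarrow> 'w \<Rightarrow> ('p, 'c + 'a) form \<Rightarrow> bool" where
  "verified M w (Atom P ts) \<longleftrightarrow> map (tval (pos M w)) ts \<in> pred_int (pos M w) P"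
| "verified M w \<^bold>\<bottom> \<longleftrightarrow> False"
| "verified M w (\<Phi> \<^bold>\<longrightarrow> \<Psi>) \<longleftrightarrow> \<not> verified M w \<Phi> \<or> verified M w \<Psi>"
| "verified M w (\<Phi> \<^bold>\<and> \<Psi>) \<longleftrightarrow> verified M w \<Phi> \<and> verified M w \<Psi>"
| "verified M w (\<Phi> \<^bold>\<or> \<Psi>) \<longleftrightarrow> verified M w \<Phi> \<or> verified M w \<Psi>"
| "verified M w (\<^bold>\<sim> \<Phi>) \<longleftrightarrow> falsified M w \<Phi>"
| "verified M w (\<^bold>\<box> \<Phi>) \<longleftrightarrow> (\<forall>v. (w, v) \<in> acc M \<longrightarrow> verified M v \<Phi>)"
| "verified M w (\<^bold>\<diamond> \<Phi>) \<longleftrightarrow> (\<exists>v. (w, v) \<in> acc M \<and> verified M v \<Phi>)"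
| "verified M w (\<^bold>\<forall>x. \<Phi>) \<longleftrightarrow> (\<forall>a \<in> world_domain M w. verified M w (subst1 \<Phi> x (name a)))"
| "verified M w (\<^bold>\<exists>x. \<Phi>) \<longleftrightarrow> (\<exists>a \<in> world_domain M w. verified M w (subst1 \<Phi> x (name a)))"
| "falsified M w (Atom P ts) \<longleftrightarrow> map (tval (neg M w)) ts \<in> pred_int (neg M w) P"
| "falsified M w \<^bold>\<bottom> \<longleftrightarrow> True"
| "falsified M w (\<Phi> \<^bold>\<longrightarrow> \<Psi>) \<longleftrightarrow> verified M w \<Phi> \<and> falsified M w \<Psi>"
| "falsified M w (\<Phi> \<^bold>\<and> \<Psi>) \<longleftrightarrow> falsified M w \<Phi> \<or> falsified M w \<Psi>"
| "falsified M w (\<Phi> \<^bold>\<or> \<Psi>) \<longleftrightarrow> falsified M w \<Phi> \<and> falsified M w \<Psi>"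
| "falsified M w (\<^bold>\<sim> \<Phi>) \<longleftrightarrow> verified M w \<Phi>"
| "falsified M w (\<^bold>\<box> \<Phi>) \<longleftrightarrow> (\<exists>v. (w, v) \<in> acc M \<and> falsified M v \<Phi>)"
| "falsified M w (\<^bold>\<diamond> \<Phi>) \<longleftrightarrow> (\<forall>v. (w, v) \<in> acc M \<longrightarrow> falsified M v \<Phi>)"
| "falsified M w (\<^bold>\<forall>x. \<Phi>) \<longleftrightarrow> (\<exists>a \<in> world_domain M w. falsified M w (subst1 \<Phi> x (name a)))"
| "falsified M w (\<^bold>\<exists>x. \<Phi>) \<longleftrightarrow> (\<forall>a \<in> world_domain M w. falsified M w (subst1 \<Phi> x (name a)))"
  by pat_completeness auto
termination
  by (relation "measure (\<lambda>x. case x of Inl (M, w, \<Phi>) \<Rightarrow> complexity \<Phi> | Inr (M, w, \<Phi>) \<Rightarrow> complexity \<Phi>)")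
    auto

definition ground_subst :: "'a set \<Rightarrow> (nat \<Rightarrow> ('c + 'a) trm) \<Rightarrow> bool" where
  "ground_subst A s \<longleftrightarrow> (\<forall>x. \<exists>a \<in> A. s x = name a)"

text \<open>HOL cannot quantify over types inside a formula, so the types \<open>'w\<close> of worlds and \<open>'a\<close> of
  individuals are parameters of the consequence relation; a theorem that leaves them
  schematic covers models of every size.\<close>

definition entails_sharp ::
    "'w itself \<Rightarrow> 'a itself \<Rightarrow> ('p, 'c) signature \<Rightarrow> ('p, 'c) form set \<Rightarrow> ('p, 'c) form set \<Rightarrow> bool" where
  "entails_sharp _ _ \<sigma> \<Gamma> \<Delta> \<longleftrightarrow>
     (\<forall>(M :: ('w, 'p, 'c, 'a) model) w s.
        QBK_sharp_model \<sigma> M \<longrightarrow> w \<in> worlds M \<longrightarrow> ground_subst (world_domain M w) s \<longrightarrow>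
        (\<forall>\<Phi> \<in> \<Gamma>. verified M w (expand \<Phi>)) \<longrightarrow>
        (\<exists>\<Psi> \<in> \<Delta>. verified M w (subst s (expand \<Psi>))))"

end

theory Submission
  imports Defs
begin

text \<open>A formula is valid if all its ground instances are verified at all worlds of all
  constant-domain models. Every axiom is valid and every rule preserves validity; the Barcan scheme
  uses that the domains coincide. The rules MP, BR1 and BR2 also preserve the property that all
  ground instances are verified at one fixed world, so this property passes from the sentences in
  \<open>\<Gamma>\<close> to everything obtainable from them. The delicate axioms are those instantiating
  a quantifier with a constant \<open>c\<close>: replacing \<open>c\<close> by the name of its value is
  harmless because constants keep their value along the accessibility relation.\<close>

section \<open>Substitutions\<close>

lemma tsubst_cong: "(\<And>x. x \<in> tvars t \<Longrightarrow> s x = s' x) \<Longrightarrow> tsubst s t = tsubst s' t"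
  by (cases t) auto

lemma subst_cong: "(\<And>x. x \<in> fv \<Phi> \<Longrightarrow> s x = s' x) \<Longrightarrow> subst s \<Phi> = subst s' \<Phi>"
proof (induction \<Phi> arbitrary: s s')
  case (Atom P ts)
  then show ?case by (auto intro!: tsubst_cong)
next
  case (All x \<Phi>)
  have "subst (s(x := Var x)) \<Phi> = subst (s'(x := Var x)) \<Phi>"
    using All.prems by (intro All.IH) simp
  then show ?case by simp
next
  case (Exi x \<Phi>)
  have "subst (s(x := Var x)) \<Phi> = subst (s'(x := Var x)) \<Phi>"
    using Exi.prems by (intro Exi.IH) simp
  then show ?case by simp
next
  case (Imp \<Phi> \<Psi>)
  show ?case using Imp.IH(1)[of s s'] Imp.IH(2)[of s s'] Imp.prems by simp
next
  case (And \<Phi> \<Psi>)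
  show ?case using And.IH(1)[of s s'] And.IH(2)[of s s'] And.prems by simp
next
  case (Or \<Phi> \<Psi>)
  show ?case using Or.IH(1)[of s s'] Or.IH(2)[of s s'] Or.prems by simp
next
  case (SNeg \<Phi>)
  show ?case using SNeg.IH[of s s'] SNeg.prems by simp
next
  case (Box \<Phi>)
  show ?case using Box.IH[of s s'] Box.prems by simp
next
  case (Dia \<Phi>)
  show ?case using Dia.IH[of s s'] Dia.prems by simp
qed simp

lemma tsubst_Var [simp]: "tsubst Var t = t"
  by (cases t) auto

lemma subst_Var [simp]: "subst Var \<Phi> = \<Phi>"
  by (induction \<Phi>) (simp_all add: map_idI)

lemma subst_sentence: "fv \<Phi> = {} \<Longrightarrow> subst s \<Phi> = \<Phi>"
  using subst_cong[of \<Phi> s Var] by simp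

lemma subst_upd_notin_fv: "x \<notin> fv \<Phi> \<Longrightarrow> subst (s(x := t)) \<Phi> = subst s \<Phi>"
  by (rule subst_cong) auto

section \<open>Composition of substitutions\<close>

lemma tsubst_tsubst: "tsubst s (tsubst r t) = tsubst (\<lambda>y. tsubst s (r y)) t"
  by (cases t) auto

text \<open>Bound variables are not renamed, so capture must be excluded: each \<open>r y\<close> is
  either untouched or closed. Resetting \<open>r\<close> at a bound variable preserves this
  condition, and closed values do not see the simultaneous reset of \<open>s\<close>.\<close>

lemma subst_subst:
  assumes "\<And>y. r y = Var y \<or> tvars (r y) = {}"
  shows "subst s (subst r \<Phi>) = subst (\<lambda>y. tsubst s (r y)) \<Phi>"
  using assms
proof (induction \<Phi> arbitrary: s r)
  case (Atom P ts)
  then show ?case by (simp add: tsubst_tsubst)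
next
  case (All x \<Phi>)
  have "tsubst (s(x := Var x)) ((r(x := Var x)) y) = ((\<lambda>y. tsubst s (r y))(x := Var x)) y" for y
    using All.prems[of y] by (auto intro!: tsubst_cong)
  moreover have "(r(x := Var x)) y = Var y \<or> tvars ((r(x := Var x)) y) = {}" for y
    using All.prems[of y] by simp
  ultimately show ?case
    using All.IH[of "r(x := Var x)" "s(x := Var x)"] by (simp del: fun_upd_apply)
next
  case (Exi x \<Phi>)
  have "tsubst (s(x := Var x)) ((r(x := Var x)) y) = ((\<lambda>y. tsubst s (r y))(x := Var x)) y" for y
    using Exi.prems[of y] by (auto intro!: tsubst_cong)
  moreover have "(r(x := Var x)) y = Var y \<or> tvars ((r(x := Var x)) y) = {}" for y
    using Exi.prems[of y] by simp
  ultimately show ?case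
    using Exi.IH[of "r(x := Var x)" "s(x := Var x)"] by (simp del: fun_upd_apply)
qed auto

text \<open>Turns the instances by names in the quantifier clauses into updates of \<open>s\<close>.
  As the values of \<open>s\<close> are closed, the only free \<open>x\<close> that
  \<open>subst1\<close> can meet is the one kept by \<open>x := Var x\<close>.\<close>

lemma subst1_subst_upd:
  assumes "\<And>y. tvars (s y) = {}"
  shows "subst1 (subst (s(x := Var x)) \<Phi>) x t = subst (s(x := t)) \<Phi>"
proof -
  have "tsubst (Var(x := t)) ((s(x := Var x)) y) = (s(x := t)) y" for y
    using tsubst_cong[of "s y" "Var(x := t)" Var] assms[of y] by simp
  moreover have "(s(x := Var x)) y = Var y \<or> tvars ((s(x := Var x)) y) = {}" for y
    using assms by simp
  ultimately show ?thesis
    unfolding subst1_def by (subst subst_subst) presburger+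
qed

lemma subst_subst1:
  assumes "free_for t x \<Phi>"
  shows "subst s (subst1 \<Phi> x t) = subst (s(x := tsubst s t)) \<Phi>"
  using assms unfolding subst1_def
proof (induction \<Phi> arbitrary: s)
  case (Atom P ts)
  have "(\<lambda>y. tsubst s ((Var(x := t)) y)) = s(x := tsubst s t)" by auto
  then show ?case by (simp add: tsubst_tsubst del: fun_upd_apply)
next
  case (All y \<Phi>)
  consider "x = y" | "x \<noteq> y" "x \<notin> fv \<Phi>" | "x \<noteq> y" "y \<notin> tvars t" "free_for t x \<Phi>"
    using All.prems by auto
  then show ?case
  proof cases
    case 2
    have "subst ((Var(x := t))(y := Var y)) \<Phi> = subst Var \<Phi>"
      and "subst ((s(x := tsubst s t))(y := Var y)) \<Phi> = subst (s(y := Var y)) \<Phi>"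
      using 2 by (intro subst_cong; auto)+
    then show ?thesis by (simp del: fun_upd_apply)
  next
    case 3
    \<comment> \<open>The bound \<open>y\<close> does not occur in \<open>t\<close>, so the value of
      \<open>t\<close> under \<open>s\<close> survives the reset at \<open>y\<close>, and the
      updates at \<open>x\<close> and \<open>y\<close> commute.\<close>
    have "tsubst (s(y := Var y)) t = tsubst s t" using 3 by (intro tsubst_cong) auto
    moreover have "(Var(x := t))(y := Var y) = Var(x := t)"
      and "(s(x := tsubst s t))(y := Var y) = (s(y := Var y))(x := tsubst s t)"
      using 3 by auto
    ultimately show ?thesis using 3 All.IH[of "s(y := Var y)"] by (simp del: fun_upd_apply)
  qed (simp del: fun_upd_apply)
next
  case (Exi y \<Phi>)
  consider "x = y" | "x \<noteq> y" "x \<notin> fv \<Phi>" | "x \<noteq> y" "y \<notin> tvars t" "free_for t x \<Phi>"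
    using Exi.prems by auto
  then show ?case
  proof cases
    case 2
    have "subst ((Var(x := t))(y := Var y)) \<Phi> = subst Var \<Phi>"
      and "subst ((s(x := tsubst s t))(y := Var y)) \<Phi> = subst (s(y := Var y)) \<Phi>"
      using 2 by (intro subst_cong; auto)+
    then show ?thesis by (simp del: fun_upd_apply)
  next
    case 3
    have "tsubst (s(y := Var y)) t = tsubst s t" using 3 by (intro tsubst_cong) auto
    moreover have "(Var(x := t))(y := Var y) = Var(x := t)"
      and "(s(x := tsubst s t))(y := Var y) = (s(y := Var y))(x := tsubst s t)"
      using 3 by auto
    ultimately show ?thesis using 3 Exi.IH[of "s(y := Var y)"] by (simp del: fun_upd_apply)
  qed (simp del: fun_upd_apply)
qed auto

text \<open>The quantifier axioms restrict \<open>t\<close> to the language only through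
  well-formedness of the whole instance. A free occurrence of the variable puts \<open>t\<close>
  into that instance.\<close>

lemma wf_form_subst_Term: "wf_form \<sigma> (subst r \<Phi>) \<Longrightarrow> y \<in> fv \<Phi> \<Longrightarrow> r y \<in> Term \<sigma>"
proof (induction \<Phi> arbitrary: r)
  case (Atom P ts)
  then obtain t where "t \<in> set ts" "t = Var y"
    by (metis (no_types) UN_E empty_iff fv.simps(1) singletonD trm.exhaust tvars.simps)
  with Atom.prems(1) show ?case by force
next
  case (All x \<Phi>)
  have "(r(x := Var x)) y \<in> Term \<sigma>" using All.prems by (intro All.IH) (simp_all del: fun_upd_apply)
  then show ?case using All.prems(2) by simp
next
  case (Exi x \<Phi>)
  have "(r(x := Var x)) y \<in> Term \<sigma>" using Exi.prems by (intro Exi.IH) (simp_all del: fun_upd_apply)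
  then show ?case using Exi.prems(2) by simp
qed auto

section \<open>Renaming of symbols, with \<open>expand\<close> as the intended case\<close>

lemma tvars_map_trm [simp]: "tvars (map_trm f t) = tvars t"
  by (cases t) auto

lemma fv_map_form [simp]: "fv (map_form f g \<Phi>) = fv \<Phi>"
  by (induction \<Phi>) auto

lemma free_for_map_form [simp]:
  "free_for (map_trm g t) x (map_form f g \<Phi>) \<longleftrightarrow> free_for t x \<Phi>"
  by (induction \<Phi>) auto

lemma map_trm_tsubst: "map_trm g (tsubst s t) = tsubst (map_trm g \<circ> s) (map_trm g t)"
  by (cases t) auto

lemma map_form_subst: "map_form f g (subst s \<Phi>) = subst (map_trm g \<circ> s) (map_form f g \<Phi>)"
  by (induction \<Phi> arbitrary: s) (simp_all add: map_trm_tsubst fun_upd_comp)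

lemma map_form_subst1:
  "map_form f g (subst1 \<Phi> x t) = subst1 (map_form f g \<Phi>) x (map_trm g t)"
proof -
  have "map_trm g \<circ> Var(x := t) = Var(x := map_trm g t)" by auto
  then show ?thesis by (simp add: subst1_def map_form_subst)
qed

section \<open>Ground instances in constant-domain models\<close>

lemma ground_subst_tvars: "ground_subst A s \<Longrightarrow> tvars (s y) = {}"
  unfolding ground_subst_def by (metis tvars.simps(2))

lemma ground_subst_upd: "ground_subst A s \<Longrightarrow> a \<in> A \<Longrightarrow> ground_subst A (s(x := name a))"
  unfolding ground_subst_def by auto

lemma QBK_sharp_model_accD:
  assumes "QBK_sharp_model \<sigma> M" "(w, v) \<in> acc M"
  shows "w \<in> worlds M" "v \<in> worlds M" "world_domain M v = world_domain M w"
    and "c \<in> constants \<sigma> \<Longrightarrow> const_int (pos M v) c = const_int (pos M w) c"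
proof -
  show w: "w \<in> worlds M" and v: "v \<in> worlds M"
    using assms unfolding QBK_sharp_model_def QBK_model_def by auto
  then show "world_domain M v = world_domain M w"
    using assms unfolding QBK_sharp_model_def by blast
  show "const_int (pos M v) c = const_int (pos M w) c" if "c \<in> constants \<sigma>"
    using that assms unfolding QBK_sharp_model_def QBK_model_def by fastforce
qed

lemma QBK_sharp_model_worldD:
  assumes "QBK_sharp_model \<sigma> M" "w \<in> worlds M"
  shows "world_domain M w \<noteq> {}"
    and "c \<in> constants \<sigma> \<Longrightarrow> const_int (pos M w) c \<in> world_domain M w"
    and "c \<in> constants \<sigma> \<Longrightarrow> const_int (neg M w) c = const_int (pos M w) c"
  using assms unfolding QBK_sharp_model_def QBK_model_def is_struct_def by auto

text \<open>Instances of quantifier axioms may contain constants where the quantifier clauses supply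
  names; \<open>s'\<close> replaces some of these constants by names. Relating whole substitutions
  lets an induction cross quantifiers: both sides then receive the same name.\<close>

definition names_constants ::
    "('p, 'c) signature \<Rightarrow> ('w, 'p, 'c, 'a) model \<Rightarrow> 'w \<Rightarrow>
     (nat \<Rightarrow> ('c + 'a) trm) \<Rightarrow> (nat \<Rightarrow> ('c + 'a) trm) \<Rightarrow> bool" where
  "names_constants \<sigma> M w s s' \<longleftrightarrow>
     (\<forall>x. tvars (s x) = {} \<and>
       (s' x = s x \<or>
        (\<exists>c \<in> constants \<sigma>. s x = Cst (Inl c) \<and> s' x = name (const_int (pos M w) c))))"

lemma names_constants_tvars:
  assumes "names_constants \<sigma> M w s s'"
  shows "tvars (s x) = {}" "tvars (s' x) = {}"
  using assms unfolding names_constants_def by (metis tvars.simps(2))+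

lemma names_constants_upd:
  "names_constants \<sigma> M w s s' \<Longrightarrow> names_constants \<sigma> M w (s(x := name a)) (s'(x := name a))"
  unfolding names_constants_def by auto

text \<open>The name chosen from the value of \<open>c\<close> at \<open>w\<close> still denotes the
  value of \<open>c\<close> at \<open>v\<close>.\<close>

lemma names_constants_acc:
  "QBK_sharp_model \<sigma> M \<Longrightarrow> names_constants \<sigma> M w s s' \<Longrightarrow> (w, v) \<in> acc M \<Longrightarrow>
    names_constants \<sigma> M v s s'"
  unfolding names_constants_def by (metis QBK_sharp_model_accD(4))

text \<open>The names are taken from the positive structure; they fit the negative one because both
  interpret the constants of \<open>\<sigma>\<close> alike.\<close>

lemma names_constants_tval:
  assumes "QBK_sharp_model \<sigma> M" "w \<in> worlds M" "names_constants \<sigma> M w s s'"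
  shows "tval (pos M w) (tsubst s t) = tval (pos M w) (tsubst s' t)"
    and "tval (neg M w) (tsubst s t) = tval (neg M w) (tsubst s' t)"
proof -
  have "tval (pos M w) (s x) = tval (pos M w) (s' x)
      \<and> tval (neg M w) (s x) = tval (neg M w) (s' x)" for x
    using assms(3)[unfolded names_constants_def, rule_format, of x]
      QBK_sharp_model_worldD(3)[OF assms(1,2)] by auto
  then show "tval (pos M w) (tsubst s t) = tval (pos M w) (tsubst s' t)"
    and "tval (neg M w) (tsubst s t) = tval (neg M w) (tsubst s' t)"
    by (cases t; simp)+
qed

text \<open>Verification and falsification are treated together because strong negation swaps them.
  The world varies for the modal operators and the substitutions vary for the quantifiers.\<close>

lemma verified_names_constants:
  assumes "QBK_sharp_model \<sigma> M" "w \<in> worlds M" "names_constants \<sigma> M w s s'"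
  shows "(verified M w (subst s \<Phi>) \<longleftrightarrow> verified M w (subst s' \<Phi>)) \<and>
    (falsified M w (subst s \<Phi>) \<longleftrightarrow> falsified M w (subst s' \<Phi>))"
  using assms(2,3)
proof (induction \<Phi> arbitrary: w s s')
  case (Atom P ts)
  then show ?case
    using names_constants_tval[OF assms(1) Atom] by (simp add: comp_def)
next
  case (Box \<Phi>)
  have "v \<in> worlds M \<and> names_constants \<sigma> M v s s'" if "(w, v) \<in> acc M" for v
    using that assms(1) Box.prems names_constants_acc QBK_sharp_model_accD(2) by metis
  then show ?case using Box.IH[of _ s s'] by simp blast
next
  case (Dia \<Phi>)
  have "v \<in> worlds M \<and> names_constants \<sigma> M v s s'" if "(w, v) \<in> acc M" for v
    using that assms(1) Dia.prems names_constants_acc QBK_sharp_model_accD(2) by metis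
  then show ?case using Dia.IH[of _ s s'] by simp blast
next
  case (All x \<Phi>)
  then show ?case
    using names_constants_tvars[OF All.prems(2)]
      All.IH[OF All.prems(1) names_constants_upd[OF All.prems(2)]]
    by (simp add: subst1_subst_upd del: fun_upd_apply)
next
  case (Exi x \<Phi>)
  then show ?case
    using names_constants_tvars[OF Exi.prems(2)]
      Exi.IH[OF Exi.prems(1) names_constants_upd[OF Exi.prems(2)]]
    by (simp add: subst1_subst_upd del: fun_upd_apply)
next
  case (Imp \<Phi> \<Psi>)
  show ?case using Imp.IH[OF Imp.prems] by simp
next
  case (And \<Phi> \<Psi>)
  show ?case using And.IH[OF And.prems] by simp
next
  case (Or \<Phi> \<Psi>)
  show ?case using Or.IH[OF Or.prems] by simp
next
  case (SNeg \<Phi>)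
  show ?case using SNeg.IH[OF SNeg.prems] by simp
qed simp

text \<open>Satisfaction with \<open>s\<close> in the role of a variable assignment; with
  \<open>fails\<close> it hides expansion and substitution from the later arguments.\<close>

definition holds ::
    "('w, 'p, 'c, 'a) model \<Rightarrow> 'w \<Rightarrow> (nat \<Rightarrow> ('c + 'a) trm) \<Rightarrow> ('p, 'c) form \<Rightarrow> bool" where
  "holds M w s \<Phi> \<longleftrightarrow> verified M w (subst s (expand \<Phi>))"

definition fails ::
    "('w, 'p, 'c, 'a) model \<Rightarrow> 'w \<Rightarrow> (nat \<Rightarrow> ('c + 'a) trm) \<Rightarrow> ('p, 'c) form \<Rightarrow> bool" where
  "fails M w s \<Phi> \<longleftrightarrow> falsified M w (subst s (expand \<Phi>))"

section \<open>Truth clauses for ground instances\<close>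

lemma holds_simps [simp]:
  "\<not> holds M w s \<^bold>\<bottom>"
  "holds M w s (\<Phi> \<^bold>\<longrightarrow> \<Psi>) \<longleftrightarrow> (holds M w s \<Phi> \<longrightarrow> holds M w s \<Psi>)"
  "holds M w s (\<Phi> \<^bold>\<and> \<Psi>) \<longleftrightarrow> holds M w s \<Phi> \<and> holds M w s \<Psi>"
  "holds M w s (\<Phi> \<^bold>\<or> \<Psi>) \<longleftrightarrow> holds M w s \<Phi> \<or> holds M w s \<Psi>"
  "holds M w s (\<^bold>\<sim> \<Phi>) \<longleftrightarrow> fails M w s \<Phi>"
  "holds M w s (\<^bold>\<box> \<Phi>) \<longleftrightarrow> (\<forall>v. (w, v) \<in> acc M \<longrightarrow> holds M v s \<Phi>)"
  "holds M w s (\<^bold>\<diamond> \<Phi>) \<longleftrightarrow> (\<exists>v. (w, v) \<in> acc M \<and> holds M v s \<Phi>)"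
  by (auto simp only: holds_def fails_def form.map subst.simps verified.simps)

lemma fails_simps [simp]:
  "fails M w s \<^bold>\<bottom>"
  "fails M w s (\<Phi> \<^bold>\<longrightarrow> \<Psi>) \<longleftrightarrow> holds M w s \<Phi> \<and> fails M w s \<Psi>"
  "fails M w s (\<Phi> \<^bold>\<and> \<Psi>) \<longleftrightarrow> fails M w s \<Phi> \<or> fails M w s \<Psi>"
  "fails M w s (\<Phi> \<^bold>\<or> \<Psi>) \<longleftrightarrow> fails M w s \<Phi> \<and> fails M w s \<Psi>"
  "fails M w s (\<^bold>\<sim> \<Phi>) \<longleftrightarrow> holds M w s \<Phi>"
  "fails M w s (\<^bold>\<box> \<Phi>) \<longleftrightarrow> (\<exists>v. (w, v) \<in> acc M \<and> fails M v s \<Phi>)"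
  "fails M w s (\<^bold>\<diamond> \<Phi>) \<longleftrightarrow> (\<forall>v. (w, v) \<in> acc M \<longrightarrow> fails M v s \<Phi>)"
  by (auto simp only: holds_def fails_def form.map subst.simps falsified.simps)

text \<open>The set \<open>A\<close> is not tied to \<open>w\<close>, so the clauses also apply at a
  successor while \<open>s\<close> is ground over the domain of the original world, as in the Barcan
  scheme.\<close>

lemma holds_quantifier:
  assumes "ground_subst A s"
  shows "holds M w s (\<^bold>\<forall>x. \<Phi>) \<longleftrightarrow> (\<forall>a \<in> world_domain M w. holds M w (s(x := name a)) \<Phi>)"
    and "holds M w s (\<^bold>\<exists>x. \<Phi>) \<longleftrightarrow> (\<exists>a \<in> world_domain M w. holds M w (s(x := name a)) \<Phi>)"
  by (simp_all only: holds_def form.map subst.simps verified.simps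
      subst1_subst_upd[OF ground_subst_tvars[OF assms]])

lemma fails_quantifier:
  assumes "ground_subst A s"
  shows "fails M w s (\<^bold>\<forall>x. \<Phi>) \<longleftrightarrow> (\<exists>a \<in> world_domain M w. fails M w (s(x := name a)) \<Phi>)"
    and "fails M w s (\<^bold>\<exists>x. \<Phi>) \<longleftrightarrow> (\<forall>a \<in> world_domain M w. fails M w (s(x := name a)) \<Phi>)"
  by (simp_all only: fails_def form.map subst.simps falsified.simps
      subst1_subst_upd[OF ground_subst_tvars[OF assms]])

lemma holds_upd_notin_fv: "x \<notin> fv \<Phi> \<Longrightarrow> holds M w (s(x := t)) \<Phi> \<longleftrightarrow> holds M w s \<Phi>"
  by (simp add: holds_def subst_upd_notin_fv)

text \<open>The element \<open>a\<close> is the value of \<open>t\<close>: the one named by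
  \<open>s y\<close> for a variable \<open>y\<close>, the interpretation at \<open>w\<close> for a
  constant. If \<open>x\<close> is not free, any element of the nonempty domain will do. One
  equivalence serves both quantifier axioms.\<close>

lemma holds_subst1:
  assumes M: "QBK_sharp_model \<sigma> M" "w \<in> worlds M"
    and s: "ground_subst (world_domain M w) s"
    and free: "free_for t x \<Phi>" and wf: "wf_form \<sigma> (subst1 \<Phi> x t)"
  shows "\<exists>a \<in> world_domain M w. holds M w s (subst1 \<Phi> x t) \<longleftrightarrow> holds M w (s(x := name a)) \<Phi>"
proof -
  have eq: "holds M w s (subst1 \<Phi> x t) \<longleftrightarrow> holds M w (s(x := tsubst s (map_trm Inl t))) \<Phi>"
    using free by (simp add: holds_def map_form_subst1 subst_subst1)
  show ?thesis
  proof (cases "x \<in> fv \<Phi>")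
    case False
    then show ?thesis
      using QBK_sharp_model_worldD(1)[OF M] by (auto simp: eq holds_upd_notin_fv)
  next
    case True
    show ?thesis
    proof (cases t)
      case (Var y)
      obtain a where "a \<in> world_domain M w" "s y = name a"
        using s unfolding ground_subst_def by blast
      then show ?thesis unfolding eq by (auto simp: Var)
    next
      case (Cst c)
      then have c: "c \<in> constants \<sigma>"
        using wf_form_subst_Term[OF wf[unfolded subst1_def] True] by (simp add: Term_def)
      \<comment> \<open>The two assignments differ only at \<open>x\<close>, in the constant against
        the name of its value.\<close>
      have "names_constants \<sigma> M w (s(x := Cst (Inl c))) (s(x := name (const_int (pos M w) c)))"
        using c ground_subst_tvars[OF s] by (auto simp: names_constants_def)
      from verified_names_constants[OF M this] have
        "holds M w (s(x := Cst (Inl c))) \<Phi> \<longleftrightarrow> holds M w (s(x := name (const_int (pos M w) c))) \<Phi>"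
        by (simp add: holds_def)
      then show ?thesis
        unfolding eq using QBK_sharp_model_worldD(2)[OF M c] by (auto simp: Cst)
    qed
  qed
qed

section \<open>Soundness\<close>

lemma holds_axioms:
  assumes "\<Phi> \<in> axioms" "wf_form \<sigma> \<Phi>"
    and M: "QBK_sharp_model \<sigma> M" "w \<in> worlds M"
    and s: "ground_subst (world_domain M w) s"
  shows "holds M w s \<Phi>"
  using assms(1,2)
proof (induction rule: axioms.induct)
  \<comment> \<open>Cases 22 and 23 are universal instantiation and existential introduction; the
    element equivalent to \<open>t\<close> settles both.\<close>
  case (22 t x \<Phi>)
  then have "wf_form \<sigma> (subst1 \<Phi> x t)" by simp
  from holds_subst1[OF M s 22(1) this] show ?case by (auto simp: holds_quantifier[OF s])
next
  case (23 t x \<Phi>)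
  then have "wf_form \<sigma> (subst1 \<Phi> x t)" by simp
  from holds_subst1[OF M s 23(1) this] show ?case by (auto simp: holds_quantifier[OF s])
next
  case (26 x \<Phi>)
  \<comment> \<open>Barcan scheme: a witness from the domain of a successor lies in the domain of
    \<open>w\<close>, as the two coincide.\<close>
  show ?case
    using QBK_sharp_model_accD(3)[OF M(1)] by (auto simp: holds_quantifier[OF s])
qed (auto simp: holds_quantifier[OF s] fails_quantifier[OF s])

text \<open>Moving \<open>s\<close> at \<open>x\<close> through the domain changes
  \<open>\<Psi>\<close> but not \<open>\<Phi>\<close>. The premise concerns one world only, so the
  lemma serves both for theorems of the calculus and for derivations from hypotheses.\<close>

lemma holds_BR1:
  assumes s: "ground_subst (world_domain M w) s" and x: "x \<notin> fv \<Phi>"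
    and valid: "\<And>s. ground_subst (world_domain M w) s \<Longrightarrow> holds M w s (\<Phi> \<^bold>\<longrightarrow> \<Psi>)"
  shows "holds M w s (\<Phi> \<^bold>\<longrightarrow> (\<^bold>\<forall>x. \<Psi>))"
proof -
  have "holds M w s \<Phi> \<longrightarrow> holds M w (s(x := name a)) \<Psi>" if "a \<in> world_domain M w" for a
    using valid[OF ground_subst_upd[OF s that, of x]] x by (simp add: holds_upd_notin_fv)
  then show ?thesis by (simp add: holds_quantifier[OF s])
qed

lemma holds_BR2:
  assumes s: "ground_subst (world_domain M w) s" and x: "x \<notin> fv \<Psi>"
    and valid: "\<And>s. ground_subst (world_domain M w) s \<Longrightarrow> holds M w s (\<Phi> \<^bold>\<longrightarrow> \<Psi>)"
  shows "holds M w s ((\<^bold>\<exists>x. \<Phi>) \<^bold>\<longrightarrow> \<Psi>)"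
proof -
  have "holds M w (s(x := name a)) \<Phi> \<longrightarrow> holds M w s \<Psi>" if "a \<in> world_domain M w" for a
    using valid[OF ground_subst_upd[OF s that, of x]] x by (simp add: holds_upd_notin_fv)
  then show ?thesis by (auto simp: holds_quantifier[OF s])
qed

text \<open>The induction must range over all worlds, because MB and MD use their premise at
  successors.\<close>

lemma holds_QBK_sharp:
  assumes "\<Phi> \<in> QBK_sharp \<sigma>" and M: "QBK_sharp_model \<sigma> M"
    and "w \<in> worlds M" "ground_subst (world_domain M w) s"
  shows "holds M w s \<Phi>"
  using assms(1,3,4)
proof (induction arbitrary: w s)
  case (Ax \<Phi>)
  then show ?case using holds_axioms[OF _ _ M] by (simp add: Form_def)
next
  case (MP \<Phi> \<Psi>)
  show ?case using MP.IH(1)[OF MP.prems] MP.IH(2)[OF MP.prems] by simp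
next
  case (MB \<Phi> \<Psi>)
  \<comment> \<open>As the domains agree, \<open>s\<close> is ground over the domain of
    \<open>v\<close> too, so the induction hypothesis applies there.\<close>
  have "holds M v s (\<Phi> \<^bold>\<longrightarrow> \<Psi>)" if "(w, v) \<in> acc M" for v
    using MB.prems QBK_sharp_model_accD(2,3)[OF M that] by (intro MB.IH) simp_all
  then show ?case by simp
next
  case (MD \<Phi> \<Psi>)
  have "holds M v s (\<Phi> \<^bold>\<longrightarrow> \<Psi>)" if "(w, v) \<in> acc M" for v
    using MD.prems QBK_sharp_model_accD(2,3)[OF M that] by (intro MD.IH) simp_all
  then show ?case by auto
next
  case (BR1 \<Phi> \<Psi> x)
  show ?case by (rule holds_BR1[OF BR1.prems(2) BR1.hyps(2) BR1.IH[OF BR1.prems(1)]])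
next
  case (BR2 \<Phi> \<Psi> x)
  show ?case by (rule holds_BR2[OF BR2.prems(2) BR2.hyps(2) BR2.IH[OF BR2.prems(1)]])
qed

lemma holds_sentence: "fv \<Phi> = {} \<Longrightarrow> holds M w s \<Phi> \<longleftrightarrow> verified M w (expand \<Phi>)"
  by (simp add: holds_def subst_sentence)

text \<open>Only \<open>s\<close> varies in the induction; \<open>w\<close> stays fixed because the
  hypotheses are assumed at \<open>w\<close> alone and no modal rule occurs. Being sentences, they
  hold under every \<open>s\<close>, which supports the changes of \<open>s\<close> in BR1 and
  BR2.\<close>

lemma holds_obtainable:
  assumes "\<Phi> \<in> obtainable \<sigma> \<Gamma>" "\<Gamma> \<subseteq> Sent \<sigma>"
    and M: "QBK_sharp_model \<sigma> M" "w \<in> worlds M" and "\<forall>\<Psi> \<in> \<Gamma>. verified M w (expand \<Psi>)"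
    and "ground_subst (world_domain M w) s"
  shows "holds M w s \<Phi>"
  using assms(1,6)
proof (induction arbitrary: s)
  case (Hyp \<Phi>)
  show ?case
  proof (cases "\<Phi> \<in> \<Gamma>")
    case True
    then have "fv \<Phi> = {}" using assms(2) by (auto simp: Sent_def)
    then show ?thesis using True assms(5) by (simp only: holds_sentence)
  next
    case False
    then have "\<Phi> \<in> QBK_sharp \<sigma>" using Hyp.hyps by simp
    from holds_QBK_sharp[OF this M Hyp.prems] show ?thesis .
  qed
next
  case (MP \<Phi> \<Psi>)
  show ?case using MP.IH(1)[OF MP.prems] MP.IH(2)[OF MP.prems] by simp
next
  case (BR1 \<Phi> \<Psi> x)
  show ?case by (rule holds_BR1[OF BR1.prems BR1.hyps(2) BR1.IH])
next
  case (BR2 \<Phi> \<Psi> x)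
  show ?case by (rule holds_BR2[OF BR2.prems BR2.hyps(2) BR2.IH])
qed

lemma holds_disj_list: "holds M w s (disj_list \<Phi>s) \<longleftrightarrow> (\<exists>\<Phi> \<in> set \<Phi>s. holds M w s \<Phi>)"
  by (induction \<Phi>s rule: disj_list.induct) auto

theorem theorem19:
  fixes \<sigma> :: "('p, 'c) signature"
    and \<Gamma> \<Delta> :: "('p, 'c) form set"
  assumes "\<Gamma> \<subseteq> Sent \<sigma>"
    and "\<Delta> \<subseteq> Form \<sigma>"
    and "derives_sharp \<sigma> \<Gamma> \<Delta>"
  shows "entails_sharp TYPE('w) TYPE('a) \<sigma> \<Gamma> \<Delta>"
proof -
  from assms(3) obtain \<Phi>s where \<Phi>s: "set \<Phi>s \<subseteq> \<Delta>" "disj_list \<Phi>s \<in> obtainable \<sigma> \<Gamma>"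
    unfolding derives_sharp_def Disj_def by auto
  show ?thesis
    unfolding entails_sharp_def
  proof (intro allI impI)
    fix M :: "('w, 'p, 'c, 'a) model" and w and s :: "nat \<Rightarrow> ('c + 'a) trm"
    assume "QBK_sharp_model \<sigma> M" "w \<in> worlds M" "ground_subst (world_domain M w) s"
      and "\<forall>\<Phi> \<in> \<Gamma>. verified M w (expand \<Phi>)"
    then have "holds M w s (disj_list \<Phi>s)"
      by (intro holds_obtainable[OF \<Phi>s(2) assms(1)])
    \<comment> \<open>The empty disjunction is \<open>\<bottom>\<close>, which never holds, so a
      disjunct that holds exists, under the same \<open>s\<close>.\<close>
    then obtain \<Psi> where "\<Psi> \<in> set \<Phi>s" "holds M w s \<Psi>"
      unfolding holds_disj_list by blast
    then show "\<exists>\<Psi> \<in> \<Delta>. verified M w (subst s (expand \<Psi>))"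
      using \<Phi>s(1) unfolding holds_def by blast
  qed
qed

end
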